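(* Let $n\ge1$ and $p\ge 1$ be integers, let $L>m>0$ and $\kappa=L/m$. Let $\mathscr{F}\supset\mathscr{F}^q_{m,L}$ be any set of time-varying cost functions containing $\mathscr{F}^q_{m,L}$. Let $\Sigma(\alpha,\beta,m,L)$ be any algorithm of the form $$x(t+1)=x(t)+\sum_{j=0}^{k-1}\beta_j\big(x(t-j)-x(t-j-1)\big)-\sum_{j=0}^{k}\alpha_j\nabla_x f(x(t-j),t-j),$$ with $\alpha_j,\beta_j\in\mathbb{R}$ and $\sum_{j=0}^k\alpha_j\neq0$, which is globally convergent with zero steady-state error for every $f\in\mathscr{F}$. Then its (worst-case) convergence rate over $\mathscr{F}$ is at least $$\left(\frac{\sqrt{\kappa}-1}{\sqrt{\kappa}+1}\right)^{1/n}=\left(\frac{\sqrt{L}-\sqrt{m}}{\sqrt{L}+\sqrt{m}}\right)^{1/n}.$$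
   Context: Quadratic class. $\mathscr{F}^q_{m,L}$ (for the fixed $n,p$) is the set of all functions $f(x,t)=\tfrac12 (x-x^*(t))^T\Delta(x-x^*(t))+c(x^*(t))$, $x\in\mathbb{R}^p$, where $\Delta=\Delta^T\in\mathbb{R}^{p\times p}$ satisfies $mI\le\Delta\le LI$, $x^*(t)=a_0+a_1t+\dots+a_{n-1}t^{n-1}$ with arbitrary constant vectors $a_i\in\mathbb{R}^p$, and $c(x^*(t))\in\mathbb{R}$. General class. Every $f\in\mathscr{F}$ is a function $f(x,t)$ with $x\in\mathbb{R}^p$, differentiable in $x$, with a unique minimizer $x^*(t)$ of $f(\cdot,t)$ for each $t$. Algorithm. $k\ge 1$ is an integer, $\alpha=(\alpha_0,\dots,\alpha_k)$, $\beta=(\beta_0,\dots,\beta_{k-1})$; the parameters do not depend on $f$. The recursion is initialized with arbitrary $x(0),\dots,x(k)\in\mathbb{R}^p$ and run for $t=k,k+1,\dots$. It is globally convergent with zero steady-state error for $f$ if $x(t)-x^*(t)\to0$ as $t\to\infty$ for all initial values. Convergence rate over $\mathscr{F}$. This is the worst-case root-convergence factor: the supremum, over all $f\in\mathscr{F}$ and all initial values $x(0),\dots,x(k)$, of $\limsup_{t\to\infty}\|x(t)-x^*(t)\|^{1/t}$. *)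

theory Defs
  imports "HOL-Analysis.Analysis"
begin

type_synonym 'p cost = "real^'p \<Rightarrow> nat \<Rightarrow> real"

definition grad :: "(real^'p \<Rightarrow> real) \<Rightarrow> real^'p \<Rightarrow> real^'p"
  where "grad g x = (THE D. GDERIV g x :> D)"

definition minimizer :: "'p::finite cost \<Rightarrow> nat \<Rightarrow> real^'p"
  where "minimizer f t = (ARG_MIN (\<lambda>x. f x t) x. True)"

definition admissible_cost :: "'p::finite cost \<Rightarrow> bool"
  where "admissible_cost f \<longleftrightarrow>
    (\<forall>t. (\<forall>x. (\<lambda>y. f y t) differentiable (at x)) \<and>
         (\<exists>!x. is_arg_min (\<lambda>y. f y t) (\<lambda>_. True) x))"

text \<open>Loewner order; used below only between symmetric matrices.\<close>

definition loewner_le :: "real^'p^'p \<Rightarrow> real^'p^'p \<Rightarrow> bool"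
  where "loewner_le A B \<longleftrightarrow> (\<forall>v. 0 \<le> v \<bullet> ((B - A) *v v))"

definition poly_traj :: "nat \<Rightarrow> (nat \<Rightarrow> real^'p) \<Rightarrow> nat \<Rightarrow> real^'p"
  where "poly_traj n a t = (\<Sum>i<n. (real t ^ i) *\<^sub>R a i)"

text \<open>
  The offset \<open>c\<close> is, as written, a function of the point \<open>x\<^sup>*(t)\<close>, not of \<open>t\<close> separately.
\<close>

definition quadratic_class :: "nat \<Rightarrow> real \<Rightarrow> real \<Rightarrow> 'p::finite cost set"
  where "quadratic_class n m L =
    {f. \<exists>(\<Delta> :: real^'p^'p) a c.
          transpose \<Delta> = \<Delta> \<and> loewner_le (mat m) \<Delta> \<and> loewner_le \<Delta> (mat L) \<and>
          f = (\<lambda>x t. 1/2 * ((x - poly_traj n a t) \<bullet> (\<Delta> *v (x - poly_traj n a t)))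
                     + c (poly_traj n a t))}"

text \<open>
  The recursion determines \<open>x\<close> from \<open>x 0, \<dots>, x k\<close>, which are unconstrained; hence quantifying
  over all \<open>x\<close> with \<open>is_run k \<alpha> \<beta> f x\<close> is quantifying over all initial values. The truncated
  subtractions are exact, since \<open>j \<le> k \<le> t\<close> (and \<open>j < k\<close> in the first sum).
\<close>

definition is_run ::
  "nat \<Rightarrow> (nat \<Rightarrow> real) \<Rightarrow> (nat \<Rightarrow> real) \<Rightarrow> 'p::finite cost \<Rightarrow> (nat \<Rightarrow> real^'p) \<Rightarrow> bool"
  where "is_run k \<alpha> \<beta> f x \<longleftrightarrow>
    (\<forall>t\<ge>k. x (t + 1) = x t
        + (\<Sum>j<k. \<beta> j *\<^sub>R (x (t - j) - x (t - j - 1)))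
        - (\<Sum>j\<le>k. \<alpha> j *\<^sub>R grad (\<lambda>y. f y (t - j)) (x (t - j))))"

definition globally_convergent ::
  "nat \<Rightarrow> (nat \<Rightarrow> real) \<Rightarrow> (nat \<Rightarrow> real) \<Rightarrow> 'p::finite cost \<Rightarrow> bool"
  where "globally_convergent k \<alpha> \<beta> f \<longleftrightarrow>
    (\<forall>x. is_run k \<alpha> \<beta> f x \<longrightarrow> (\<lambda>t. x t - minimizer f t) \<longlonglongrightarrow> 0)"

text \<open>
  The supremum is taken in the extended reals, so that it exists unconditionally.
\<close>

definition convergence_rate ::
  "nat \<Rightarrow> (nat \<Rightarrow> real) \<Rightarrow> (nat \<Rightarrow> real) \<Rightarrow> 'p::finite cost set \<Rightarrow> ereal"
  where "convergence_rate k \<alpha> \<beta> F =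
    Sup {limsup (\<lambda>t. ereal (root t (norm (x t - minimizer f t)))) | f x.
           f \<in> F \<and> is_run k \<alpha> \<beta> f x}"

end

theory Submission
  imports Defs "HOL-Complex_Analysis.Conformal_Mappings"
begin

text \<open>
  For \<open>\<Delta> = \<lambda> I\<close> the error obeys a linear recursion; in the backward shift \<open>w\<close> its characteristic function
  is \<open>a w + \<lambda> * p w\<close>, with \<open>a\<close> built from \<open>\<beta>\<close> and \<open>p\<close> from \<open>\<alpha>\<close>. Tracking every polynomial
  target of degree less than \<open>n\<close> forces \<open>(1 - w) ^ n\<close> to divide \<open>a\<close>. If the rate is below \<open>\<rho>\<close>, then
  \<open>a + \<lambda> p\<close> has no zero in \<open>\<bar>w\<bar> < 1 / \<rho>\<close> for any \<open>\<lambda> \<in> [m, L]\<close>, that is, \<open>- a / p\<close> omits the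
  segment \<open>[m, L]\<close>. Mapping the complement of the segment conformally onto the unit disc, with
  \<open>\<infinity>\<close> going to \<open>q = (sqrt L - sqrt m) / (sqrt L + sqrt m)\<close> and \<open>0\<close> to \<open>0\<close>, gives a function from the disc
  of radius \<open>1 / \<rho>\<close> to the unit disc with value \<open>q\<close> at \<open>0\<close> and a zero of order \<open>n\<close> at \<open>1\<close>.
  The Schwarz lemma, in its version for zeros of higher order, yields \<open>q \<le> \<rho> ^ n\<close>.
\<close>

section \<open>Conformal maps and a Schwarz-type bound on discs\<close>

lemma one_minus_square_notin_nonpos_Reals:
  fixes v :: complex
  assumes "\<And>x. v = of_real x \<Longrightarrow> \<bar>x\<bar> < 1"
  shows "1 - v\<^sup>2 \<notin> \<real>\<^sub>\<le>\<^sub>0"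
proof
  assume "1 - v\<^sup>2 \<in> \<real>\<^sub>\<le>\<^sub>0"
  then obtain r where r: "1 - v\<^sup>2 = of_real r" "r \<le> 0"
    by (auto elim: nonpos_Reals_cases)
  then have "v\<^sup>2 = (of_real (sqrt (1 - r)))\<^sup>2"
    by (simp add: algebra_simps flip: of_real_power)
  then have "v = of_real (sqrt (1 - r)) \<or> v = of_real (- sqrt (1 - r))"
    by (simp add: power2_eq_iff)
  then have "\<bar>sqrt (1 - r)\<bar> < 1"
    using assms by (metis abs_minus_cancel)
  with r(2) show False by simp
qed

lemma Re_csqrt_pos:
  assumes "z \<notin> \<real>\<^sub>\<le>\<^sub>0" shows "0 < Re (csqrt z)"
proof (rule ccontr)
  assume "\<not> ?thesis"
  then have 0: "Re (csqrt z) = 0" using Re_csqrt[of z] by linarith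
  have "z = (csqrt z)\<^sup>2" by simp
  also have "\<dots> = of_real (- (Im (csqrt z))\<^sup>2)"
    using 0 by (simp add: complex_eq_iff power2_eq_square del: csqrt.simps power2_csqrt)
  finally have "z \<in> \<real>\<^sub>\<le>\<^sub>0" by (metis nonpos_Reals_of_real_iff neg_le_0_iff_le zero_le_power2)
  with assms show False by simp
qed

text \<open>\<open>v \<mapsto> v / (1 + csqrt (1 - v\<^sup>2))\<close> is the branch with values in the unit disc of the inverse of
  \<open>\<zeta> \<mapsto> 2 \<zeta> / (1 + \<zeta>\<^sup>2)\<close> on the plane slit along \<open>{x. \<bar>x\<bar> \<ge> 1}\<close>.\<close>

lemma slit_plane_to_disc:
  fixes v :: complex
  assumes "\<And>x. v = of_real x \<Longrightarrow> \<bar>x\<bar> < 1"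
  defines "s \<equiv> csqrt (1 - v\<^sup>2)"
  defines "z \<equiv> v / (1 + s)"
  shows "1 + s \<noteq> 0" "norm z < 1" "v * (1 + z\<^sup>2) = 2 * z"
proof -
  have s: "0 < Re s" unfolding s_def
    by (intro Re_csqrt_pos one_minus_square_notin_nonpos_Reals assms(1))
  show n: "1 + s \<noteq> 0" using s by (auto simp: complex_eq_iff)
  have s2: "s\<^sup>2 = 1 - v\<^sup>2" by (simp add: s_def)
  then have v2: "v\<^sup>2 = (1 - s) * (1 + s)" by (simp add: algebra_simps power2_eq_square)
  \<comment> \<open>\<open>z\<^sup>2\<close> is the Cayley transform of \<open>s\<close>, which
    carries the half-plane \<open>0 < Re s\<close> to the unit disc.\<close>
  have z2: "z\<^sup>2 = (1 - s) / (1 + s)"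
    unfolding z_def power_divide v2 using n by (simp add: power2_eq_square)
  have "(norm (1 - s))\<^sup>2 < (norm (1 + s))\<^sup>2"
    using s unfolding cmod_power2 by (simp add: power2_eq_square algebra_simps)
  then have "norm (1 - s) < norm (1 + s)" by (rule power_less_imp_less_base) simp
  then have "norm (z\<^sup>2) < 1" unfolding z2 using n by (simp add: norm_divide divide_simps)
  then show "norm z < 1" by (simp add: norm_power power_less_one_iff)
  have "1 + z\<^sup>2 = 2 / (1 + s)" unfolding z2 using n by (simp add: field_simps)
  then show "v * (1 + z\<^sup>2) = 2 * z" by (simp add: z_def)
qed

text \<open>Concerns the disc automorphism \<open>(q + z) / (1 + q * z)\<close>; stated without
  division, the strict inequality also keeps the denominator away from zero.\<close>

lemma norm_disc_automorphism_less_1: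
  fixes z :: complex and q :: real
  assumes "norm z < 1" "\<bar>q\<bar> < 1"
  shows "norm (of_real q + z) < norm (1 + of_real q * z)"
proof -
  have "(norm (1 + of_real q * z))\<^sup>2 - (norm (of_real q + z))\<^sup>2 = (1 - q\<^sup>2) * (1 - (norm z)\<^sup>2)"
    unfolding cmod_power2 by (simp add: power2_eq_square algebra_simps)
  moreover have "(1 - q\<^sup>2) * (1 - (norm z)\<^sup>2) > 0"
    using assms by (intro mult_pos_pos) (auto simp: abs_square_less_1)
  ultimately have "(norm (of_real q + z))\<^sup>2 < (norm (1 + of_real q * z))\<^sup>2" by linarith
  then show ?thesis by (rule power_less_imp_less_base) simp
qed

text \<open>The Blaschke factor \<open>r (1 - w) / (r\<^sup>2 - w)\<close> of the disc of radius \<open>r\<close> is unimodular on its boundary,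
  so dividing it out costs nothing in the maximum principle.\<close>

lemma disc_function_zero_order_bound:
  fixes \<Phi> h :: "complex \<Rightarrow> complex"
  assumes h: "h holomorphic_on ball 0 R"
    and \<Phi>: "\<And>w. w \<in> ball 0 R \<Longrightarrow> \<Phi> w = (1 - w) ^ n * h w"
    and le: "\<And>w. w \<in> ball 0 R \<Longrightarrow> norm (\<Phi> w) \<le> 1"
    and r: "0 < r" "r < R"
  shows "norm (\<Phi> 0) * r ^ n \<le> 1"
proof -
  \<comment> \<open>\<open>\<Phi>\<close> divided by the \<open>n\<close>-th power of the Blaschke
    factor, with the powers of \<open>1 - w\<close> cancelled in advance, so \<open>w = 1\<close>
    needs no separate treatment. At \<open>0\<close> the division contributes
    \<open>r ^ n\<close>.\<close>
  define K where "K w = h w * ((of_real (r\<^sup>2) - w) / of_real r) ^ n" for w :: complex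
  have sub: "cball 0 r \<subseteq> ball (0::complex) R" using r by auto
  have hol: "K holomorphic_on ball 0 R"
    unfolding K_def using r by (intro holomorphic_intros h) auto
  have "norm (K 0) \<le> 1"
  proof (rule maximum_modulus_frontier[of K "cball 0 r"])
    show "K holomorphic_on interior (cball 0 r)"
      using hol sub by (meson holomorphic_on_subset interior_subset order_trans)
    show "continuous_on (closure (cball 0 r)) K"
      using hol sub by (metis closed_cball closure_closed holomorphic_on_imp_continuous_on
          continuous_on_subset)
    show "bounded (cball (0::complex) r)" "0 \<in> cball (0::complex) r" using r by auto
    fix w :: complex assume "w \<in> frontier (cball 0 r)"
    then have w: "norm w = r" using r by (simp add: frontier_cball)
    have "of_real (r\<^sup>2) - w = w * (cnj w - 1)"
      using complex_norm_square[of w] w by (simp add: algebra_simps)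
    then have "norm (of_real (r\<^sup>2) - w) = r * norm (cnj (w - 1))" using w by (simp add: norm_mult)
    also have "\<dots> = r * norm (1 - w)" unfolding complex_mod_cnj by (simp add: norm_minus_commute)
    finally have "norm (K w) = norm (h w) * norm (1 - w) ^ n"
      unfolding K_def using r by (simp add: norm_mult norm_power norm_divide)
    also have "\<dots> = norm (\<Phi> w)" using \<Phi>[of w] w r by (simp add: norm_mult norm_power)
    also have "\<dots> \<le> 1" using le[of w] w r by simp
    finally show "norm (K w) \<le> 1" .
  qed
  moreover have "h 0 = \<Phi> 0" using \<Phi>[of 0] r by simp
  ultimately show ?thesis using r
    by (simp add: K_def norm_mult norm_power power2_eq_square)
qed

text \<open>The conformal argument for arbitrary holomorphic data: \<open>b\<close> is
  \<open>a\<close> stripped of an \<open>n\<close>-fold zero at \<open>1\<close>, and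
  \<open>p 0 = 0\<close> makes \<open>- a / p\<close> infinite at \<open>0\<close>.\<close>

lemma pencil_nonvanishing_radius_bound:
  fixes a b p :: "complex \<Rightarrow> complex" and m L :: real
  assumes mL: "0 < m" "m < L"
    and a: "a holomorphic_on ball 0 R" and b: "b holomorphic_on ball 0 R"
    and p: "p holomorphic_on ball 0 R"
    and ab: "\<And>w. w \<in> ball 0 R \<Longrightarrow> a w = (1 - w) ^ n * b w"
    and p0: "p 0 = 0"
    and nz: "\<And>w l. w \<in> ball 0 R \<Longrightarrow> m \<le> l \<Longrightarrow> l \<le> L \<Longrightarrow> a w + of_real l * p w \<noteq> 0"
    and r: "0 < r" "r < R"
  shows "(sqrt L - sqrt m) / (sqrt L + sqrt m) * r ^ n \<le> 1"
proof -
  define q c d where "q = (sqrt L - sqrt m) / (sqrt L + sqrt m)"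
    and "c = (L + m) / 2" and "d = (L - m) / 2"
  have c: "c > 0" using mL by (simp add: c_def)
  have d: "d > 0" using mL by (simp add: d_def)
  have sq: "0 < sqrt m" "sqrt m < sqrt L" using mL by simp_all
  have q: "0 < q" "q < 1" unfolding q_def
    using sq by (auto intro!: divide_pos_pos simp del: real_sqrt_less_iff real_sqrt_gt_0_iff)
  \<comment> \<open>Where \<open>a\<close> vanishes, the function \<open>v\<close> below equals
    \<open>- d / c\<close>; by this identity the corresponding point of the disc is
    \<open>- q\<close>.\<close>
  have dq: "d * (1 + q\<^sup>2) = c * (2 * q)"
  proof -
    define x y where "x = sqrt L" and "y = sqrt m"
    have xy: "L = x\<^sup>2" "m = y\<^sup>2" "x + y > 0" "q = (x - y) / (x + y)"
      using mL add_pos_pos[of x y] by (auto simp: x_def y_def q_def)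
    show ?thesis unfolding c_def d_def xy using xy(3)
      by (simp add: divide_simps) (simp add: power2_eq_square algebra_simps)
  qed
  have nzc: "a w + of_real c * p w \<noteq> 0" if "w \<in> ball 0 R" for w
    using nz[OF that, of c] mL by (simp add: c_def)
  \<comment> \<open>With \<open>u = - a / p\<close> this is \<open>d / (u - c)\<close>, which sends
    \<open>[m, L]\<close> to the two slits joined at infinity. The denominator used here has no
    zeros, so \<open>v\<close> is holomorphic even where \<open>p\<close> vanishes.\<close>
  define v where "v w = - of_real d * p w / (a w + of_real c * p w)" for w
  \<comment> \<open>A real value \<open>x\<close> with \<open>\<bar>x\<bar> \<ge> 1\<close> would
    give a zero of the pencil at the parameter \<open>c + d / x\<close>, which lies in
    \<open>[m, L]\<close>.\<close>
  have slit: "\<bar>x\<bar> < 1" if w: "w \<in> ball 0 R" and x: "v w = of_real x" for w x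
  proof (rule ccontr)
    assume "\<not> ?thesis"
    then have x1: "\<bar>x\<bar> \<ge> 1" by simp
    then have x0: "x \<noteq> 0" by auto
    have "- of_real d * p w = of_real x * (a w + of_real c * p w)"
      using x by (simp only: v_def nonzero_divide_eq_eq[OF nzc[OF w]])
    moreover have "of_real x * (a w + of_real (c + d / x) * p w)
        = of_real x * (a w + of_real c * p w) - (- of_real d * p w)"
      using x0 by (simp add: algebra_simps)
    ultimately have z: "a w + of_real (c + d / x) * p w = 0" using x0 by simp
    have "\<bar>d / x\<bar> \<le> d" using x1 d by (simp add: field_simps mult_left_le)
    moreover have "c + d = L" "c - d = m" by (simp_all add: c_def d_def field_simps)
    ultimately have "m \<le> c + d / x" "c + d / x \<le> L" by linarith+
    from nz[OF w this] z show False by simp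
  qed
  define s z where "s w = csqrt (1 - (v w)\<^sup>2)" and "z w = v w / (1 + s w)" for w
  note [holomorphic_intros] = a b p
  have v_hol [holomorphic_intros]: "v holomorphic_on ball 0 R"
    unfolding v_def using nzc by (intro holomorphic_intros) auto
  have s_hol [holomorphic_intros]: "s holomorphic_on ball 0 R"
    unfolding s_def using slit
    by (intro holomorphic_intros one_minus_square_notin_nonpos_Reals) auto
  have D: "1 + s w \<noteq> 0" "norm (z w) < 1" "v w * (1 + (z w)\<^sup>2) = 2 * z w"
    if "w \<in> ball 0 R" for w
    using slit_plane_to_disc[of "v w", OF slit[OF that]] by (auto simp: s_def z_def)
  have z_hol [holomorphic_intros]: "z holomorphic_on ball 0 R"
    unfolding z_def using D by (intro holomorphic_intros) auto
  \<comment> \<open>This automorphism moves \<open>- q\<close> to \<open>0\<close> and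
    \<open>0\<close> to \<open>q\<close>.\<close>
  define \<Phi> where "\<Phi> w = (of_real q + z w) / (1 + of_real q * z w)" for w
  have \<Phi>less: "norm (of_real q + z w) < norm (1 + of_real q * z w)" if "w \<in> ball 0 R" for w
    using norm_disc_automorphism_less_1[OF D(2)[OF that], of q] q by simp
  have den: "1 + of_real q * z w \<noteq> 0" if "w \<in> ball 0 R" for w
    using \<Phi>less[OF that] by (metis norm_not_less_zero norm_zero)
  \<comment> \<open>A closed form of \<open>\<Phi> w / (1 - w) ^ n\<close>: the factor
    \<open>v + d / c\<close> is \<open>d * a / (c * (a + c * p))\<close>, and \<open>a\<close> is
    replaced by \<open>b\<close>, so holomorphy at \<open>1\<close> is immediate.\<close>
  define h where "h w = b w * (of_real d / (of_real c * (a w + of_real c * p w)))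
      * ((1 + (z w)\<^sup>2) * of_real (1 + q\<^sup>2)) / (2 * (1 + of_real q * z w)\<^sup>2)" for w
  have "norm (\<Phi> 0) * r ^ n \<le> 1"
  proof (rule disc_function_zero_order_bound[OF _ _ _ r])
    show "h holomorphic_on ball 0 R"
      unfolding h_def using nzc den c by (intro holomorphic_intros) auto
    fix w :: complex assume w: "w \<in> ball 0 R"
    show "norm (\<Phi> w) \<le> 1"
      using \<Phi>less[OF w] by (simp add: \<Phi>_def norm_divide divide_le_eq)
    define A where "A = a w + of_real c * p w"
    have A0: "A \<noteq> 0" using nzc[OF w] by (simp add: A_def)
    have dq': "of_real d * (1 + (of_real q)\<^sup>2) = (of_real c * (2 * of_real q) :: complex)"
      using arg_cong[OF dq, of "of_real :: real \<Rightarrow> complex"] by simp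
    have vA: "of_real c * v w * A = of_real d * (a w - A)"
    proof -
      have "v w * A = - of_real d * p w" using A0 by (simp add: v_def flip: A_def)
      moreover have "a w - A = - of_real c * p w" by (simp add: A_def)
      ultimately show ?thesis by (simp add: mult.assoc)
    qed
    \<comment> \<open>\<open>v w + d / c\<close> vanishes to order \<open>n\<close> at \<open>1\<close>, and \<open>d / c = 2 q / (1 + q\<^sup>2)\<close>.\<close>
    have e1: "of_real d / (of_real c * A) * a w = v w + of_real d / of_real c"
    proof -
      have "of_real d * a w = of_real c * v w * A + of_real d * A"
        using vA by (simp add: algebra_simps)
      then show ?thesis using A0 c by (simp add: field_simps)
    qed
    have e2: "(v w + of_real d / of_real c) * ((1 + (z w)\<^sup>2) * of_real (1 + q\<^sup>2))
        = 2 * (of_real q + z w) * (1 + of_real q * z w)"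
    proof -
      have gq: "of_real d / of_real c * of_real (1 + q\<^sup>2) = (2 * of_real q :: complex)"
        using dq' c by (simp add: field_simps)
      have "(v w + of_real d / of_real c) * ((1 + (z w)\<^sup>2) * of_real (1 + q\<^sup>2))
        = (v w * (1 + (z w)\<^sup>2)) * of_real (1 + q\<^sup>2)
          + (of_real d / of_real c * of_real (1 + q\<^sup>2)) * (1 + (z w)\<^sup>2)"
        by (simp only: algebra_simps)
      also have "\<dots> = 2 * (of_real q + z w) * (1 + of_real q * z w)"
        unfolding D(3)[OF w] gq by (simp add: algebra_simps power2_eq_square)
      finally show ?thesis .
    qed
    have "(1 - w) ^ n * h w = (of_real d / (of_real c * A) * a w)
        * ((1 + (z w)\<^sup>2) * of_real (1 + q\<^sup>2)) / (2 * (1 + of_real q * z w)\<^sup>2)"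
      unfolding h_def A_def[symmetric] by (subst ab[OF w]) simp
    also have "\<dots> = \<Phi> w"
    proof -
      have "2 * X * Y / (2 * Y\<^sup>2) = X / Y" if "Y \<noteq> 0" for X Y :: complex
        using that by (simp add: power2_eq_square)
      then show ?thesis unfolding e1 e2 \<Phi>_def using den[OF w] by blast
    qed
    finally show "\<Phi> w = (1 - w) ^ n * h w" by simp
  qed
  moreover have "\<Phi> 0 = of_real q"
    by (simp add: \<Phi>_def z_def v_def p0)
  ultimately have "q * r ^ n \<le> 1" using q by simp
  then show ?thesis by (simp only: q_def)
qed

section \<open>Vanishing moments and the zero at 1\<close>

text \<open>The operator \<open>x * d/dx\<close> multiplies each coefficient by its index: it shifts
  the moments by one and, in characteristic zero, lowers the order of a zero at \<open>1\<close> by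
  exactly one.\<close>

lemma moments_zero_imp_power_dvd:
  fixes P :: "'a::field_char_0 poly"
  assumes "\<And>l. l < n \<Longrightarrow> (\<Sum>i\<le>degree P. coeff P i * of_nat i ^ l) = 0"
  shows "[:-1, 1:] ^ n dvd P"
  using assms
proof (induction n arbitrary: P)
  case (Suc n)
  show ?case
  proof (cases "P = 0 \<or> pderiv P = 0")
    case True
    have "poly P 1 = 0" using Suc.prems[of 0] by (simp add: poly_altdef)
    then have "P = 0" using True pderiv_iszero[of P] by auto
    then show ?thesis by simp
  next
    case False
    have p1: "poly P 1 = 0" using Suc.prems[of 0] by (simp add: poly_altdef)
    define Q where "Q = pCons 0 (pderiv P)"
    have Q: "coeff Q i = of_nat i * coeff P i" for i
      by (cases i) (auto simp: Q_def coeff_pderiv)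
    \<comment> \<open>The moment sums run up to the degree, so the induction hypothesis fits only if
      the degree is unchanged.\<close>
    have "degree Q = degree P"
      using False p1 by (auto simp: Q_def degree_pderiv pderiv_eq_0_iff)
    then have "[:-1, 1:] ^ n dvd Q"
      using Suc.prems[of "Suc _"] by (intro Suc.IH) (auto simp: Q mult_ac)
    then have "n \<le> order 1 Q" using False by (auto simp: Q_def order_divides)
    moreover have "order 1 Q = order 1 (pderiv P)"
    proof -
      have "Q = [:0, 1:] * pderiv P" by (simp add: Q_def)
      moreover have "order 1 [:0, 1::'a:] = 0" by (rule order_0I) simp
      ultimately show ?thesis using False by (metis order_mult add_0 mult_eq_0_iff pCons_eq_0_iff zero_neq_one)
    qed
    moreover have "order 1 P = Suc (order 1 (pderiv P))"
      using False p1 by (intro order_pderiv) auto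
    ultimately show ?thesis by (simp add: order_divides del: power_Suc)
  qed
qed simp

text \<open>Expanding \<open>(t - i) ^ l\<close>, the induction leaves only the constant term \<open>\<Sum>i. a i * (- i) ^ l\<close>.\<close>

lemma moments_zero_of_shifted_powers_vanish:
  fixes a :: "nat \<Rightarrow> real"
  assumes "\<And>l. l < n \<Longrightarrow> (\<lambda>t. \<Sum>i\<le>N. a i * (real t - real i) ^ l) \<longlonglongrightarrow> 0" and "l < n"
  shows "(\<Sum>i\<le>N. a i * real i ^ l) = 0"
  using assms(2)
proof (induction l rule: less_induct)
  case (less l)
  have "(\<Sum>i\<le>N. a i * (real t - real i) ^ l) = (\<Sum>i\<le>N. a i * real i ^ l) * (-1) ^ l" for t
  proof -
    have "(\<Sum>i\<le>N. a i * (real t - real i) ^ l)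
        = (\<Sum>i\<le>N. a i * (\<Sum>s\<le>l. real (l choose s) * (- real i) ^ s * real t ^ (l - s)))"
      using binomial_ring[of "- real _" "real t" l] by simp
    also have "\<dots> = (\<Sum>s\<le>l. (\<Sum>i\<le>N. a i * real i ^ s) * (real (l choose s) * (-1) ^ s * real t ^ (l - s)))"
      unfolding sum_distrib_left sum_distrib_right
      by (subst sum.swap) (simp add: power_minus[of "real _"] mult_ac)
    also have "\<dots> = (\<Sum>s\<le>l. if s = l then (\<Sum>i\<le>N. a i * real i ^ l) * (-1) ^ l else 0)"
    proof (rule sum.cong)
      fix s assume "s \<in> {..l}"
      then show "(\<Sum>i\<le>N. a i * real i ^ s) * (real (l choose s) * (-1) ^ s * real t ^ (l - s))
          = (if s = l then (\<Sum>i\<le>N. a i * real i ^ l) * (-1) ^ l else 0)"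
        using less.IH[of s] less.prems by (cases "s = l") simp_all
    qed simp
    finally show ?thesis by simp
  qed
  with assms(1)[OF less.prems] show ?case by (simp add: LIMSEQ_const_iff)
qed

section \<open>The recursion on isotropic quadratic costs\<close>

text \<open>Coefficients of \<open>(1 - w) * (1 - (\<Sum>j<k. \<beta> j * w ^ (j + 1)))\<close>, the
  part of the recursion acting on the iterates, in the backward shift \<open>w\<close>.\<close>

definition shift_coeff :: "nat \<Rightarrow> (nat \<Rightarrow> real) \<Rightarrow> nat \<Rightarrow> real"
  where "shift_coeff k \<beta> i = (if i = 0 then 1 else 0) - (if i = 1 then 1 else 0)
    - (\<Sum>j<k. \<beta> j * ((if i = j + 1 then 1 else 0) - (if i = j + 2 then 1 else 0)))"

lemma sum_shift_coeff:
  fixes y :: "nat \<Rightarrow> 'a::real_vector"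
  shows "(\<Sum>i\<le>k+1. shift_coeff k \<beta> i *\<^sub>R y i)
    = y 0 - y 1 - (\<Sum>j<k. \<beta> j *\<^sub>R (y (j + 1) - y (j + 2)))"
proof -
  have delta: "(\<Sum>i\<le>k+1. (if i = l then 1 else 0) *\<^sub>R y i) = y l" if "l \<le> k + 1" for l
  proof -
    have "(\<Sum>i\<le>k+1. (if i = l then 1 else 0) *\<^sub>R y i) = (\<Sum>i\<le>k+1. if i = l then y i else 0)"
      by (intro sum.cong) auto
    then show ?thesis using that by simp
  qed
  have "(\<Sum>i\<le>k+1. (\<Sum>j<k. \<beta> j * ((if i = j + 1 then 1 else 0) - (if i = j + 2 then 1 else 0))) *\<^sub>R y i)
      = (\<Sum>j<k. \<beta> j *\<^sub>R ((\<Sum>i\<le>k+1. (if i = j + 1 then 1 else 0) *\<^sub>R y i)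
          - (\<Sum>i\<le>k+1. (if i = j + 2 then 1 else 0) *\<^sub>R y i)))"
    unfolding scaleR_sum_left
    by (subst sum.swap) (simp only: scaleR_scaleR[symmetric] scaleR_sum_right[symmetric]
        scaleR_diff_left sum_subtractf)
  also have "\<dots> = (\<Sum>j<k. \<beta> j *\<^sub>R (y (j + 1) - y (j + 2)))"
  proof (intro sum.cong refl)
    fix j assume "j \<in> {..<k}"
    then have "j + 1 \<le> k + 1" "j + 2 \<le> k + 1" by auto
    then show "\<beta> j *\<^sub>R ((\<Sum>i\<le>k+1. (if i = j + 1 then 1 else 0) *\<^sub>R y i)
        - (\<Sum>i\<le>k+1. (if i = j + 2 then 1 else 0) *\<^sub>R y i)) = \<beta> j *\<^sub>R (y (j + 1) - y (j + 2))"
      by (simp only: delta)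
  qed
  finally show ?thesis
    unfolding shift_coeff_def scaleR_diff_left sum_subtractf
    by (simp only: delta[of 0] delta[of 1] le0 le_add2)
qed

definition iso_cost :: "real \<Rightarrow> (nat \<Rightarrow> real^'p) \<Rightarrow> 'p::finite cost"
  where "iso_cost l y x t = l / 2 * ((x - y t) \<bullet> (x - y t))"

lemma mat_mult_vec: "mat l *v (x :: real^'p) = l *\<^sub>R x"
  by (simp add: vec_eq_iff matrix_vector_mult_def mat_def if_distrib[of "\<lambda>c. c * _"] cong: if_cong)

lemma iso_cost_in_quadratic_class:
  assumes "m \<le> l" "l \<le> L"
  shows "iso_cost l (poly_traj n a) \<in> quadratic_class n m L"
  unfolding quadratic_class_def mem_Collect_eq
  by (rule exI[of _ "mat l"], rule exI[of _ a], rule exI[of _ "\<lambda>_. 0"])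
    (use assms in \<open>auto simp: loewner_le_def matrix_vector_mult_diff_rdistrib mat_mult_vec
      iso_cost_def fun_eq_iff simp flip: scaleR_diff_left\<close>)

lemma grad_iso_cost: "grad (\<lambda>x. iso_cost l y x t) x = l *\<^sub>R (x - y t)"
proof -
  have 1: "GDERIV (\<lambda>x. iso_cost l y x t) x :> l *\<^sub>R (x - y t)"
    unfolding gderiv_def iso_cost_def
    by (auto intro!: derivative_eq_intros simp: fun_eq_iff inner_commute algebra_simps)
  have "D = l *\<^sub>R (x - y t)" if "GDERIV (\<lambda>x. iso_cost l y x t) x :> D" for D
    using has_derivative_unique[OF that[unfolded gderiv_def] 1[unfolded gderiv_def]]
    by (metis inner_commute vector_eq_ldot)
  with 1 show ?thesis unfolding grad_def by (rule the_equality)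
qed

lemma minimizer_iso_cost:
  assumes "0 < l" shows "minimizer (iso_cost l y) t = y t"
proof -
  have "is_arg_min (\<lambda>x. iso_cost l y x t) (\<lambda>_. True) x \<longleftrightarrow> x = y t" for x
  proof
    assume "is_arg_min (\<lambda>x. iso_cost l y x t) (\<lambda>_. True) x"
    then have "\<not> iso_cost l y (y t) t < iso_cost l y x t" by (auto simp: is_arg_min_def)
    then show "x = y t" using assms inner_ge_zero[of "x - y t"]
      by (auto simp: iso_cost_def not_less mult_le_0_iff dest: antisym)
  next
    assume "x = y t"
    then show "is_arg_min (\<lambda>x. iso_cost l y x t) (\<lambda>_. True) x"
      using assms by (simp add: is_arg_min_def iso_cost_def not_less)
  qed
  then show ?thesis by (simp add: minimizer_def arg_min_def)
qed

text \<open>The gradient is linear, so the \<open>\<beta>\<close>-part acts on the iterates while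
  the \<open>\<alpha>\<close>-part sees only the error.\<close>

lemma is_run_iso_cost:
  "is_run k \<alpha> \<beta> (iso_cost l y) x \<longleftrightarrow>
    (\<forall>t\<ge>k. (\<Sum>i\<le>k+1. shift_coeff k \<beta> i *\<^sub>R x (t + 1 - i))
        + l *\<^sub>R (\<Sum>j\<le>k. \<alpha> j *\<^sub>R (x (t - j) - y (t - j))) = 0)"
proof -
  have "x (t + 1) = x t + (\<Sum>j<k. \<beta> j *\<^sub>R (x (t - j) - x (t - j - 1)))
        - (\<Sum>j\<le>k. \<alpha> j *\<^sub>R grad (\<lambda>x. iso_cost l y x (t - j)) (x (t - j)))
    \<longleftrightarrow> (\<Sum>i\<le>k+1. shift_coeff k \<beta> i *\<^sub>R x (t + 1 - i))
        + l *\<^sub>R (\<Sum>j\<le>k. \<alpha> j *\<^sub>R (x (t - j) - y (t - j))) = 0" for t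
    unfolding sum_shift_coeff grad_iso_cost
    by (simp add: scaleR_sum_right mult.commute algebra_simps numeral_2_eq_2)
  then show ?thesis by (simp add: is_run_def)
qed

text \<open>Convergence speaks only about runs, so drawing a conclusion from it requires
  one.\<close>

lemma exists_run: "\<exists>x. is_run k \<alpha> \<beta> f x"
proof -
  define \<Phi> where "\<Phi> x t = x t + (\<Sum>j<k. \<beta> j *\<^sub>R (x (t - j) - x (t - j - 1)))
        - (\<Sum>j\<le>k. \<alpha> j *\<^sub>R grad (\<lambda>y. f y (t - j)) (x (t - j)))" for x t
  \<comment> \<open>The update is applied from time \<open>0\<close> on, also before
    \<open>k\<close>: truncated subtraction never reaches beyond the current time, and the values up
    to \<open>k\<close> are free anyway.\<close>
  define x where "x = wfrec less_than (\<lambda>x t. case t of 0 \<Rightarrow> 0 | Suc s \<Rightarrow> \<Phi> x s)"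
  have "x (Suc t) = \<Phi> x t" for t
  proof -
    have "x (Suc t) = \<Phi> (cut x less_than (Suc t)) t"
      by (subst x_def, subst wfrec) (simp_all add: x_def)
    also have "\<dots> = \<Phi> x t"
      unfolding \<Phi>_def by (simp add: cut_apply)
    finally show ?thesis .
  qed
  then have "is_run k \<alpha> \<beta> f x" by (simp add: is_run_def \<Phi>_def)
  then show ?thesis by blast
qed

section \<open>Consequences of zero steady-state error\<close>

lemma tendsto_zero_shift_back:
  fixes e :: "nat \<Rightarrow> 'a::real_normed_vector"
  assumes "e \<longlonglongrightarrow> 0" shows "(\<lambda>t. e (t - j)) \<longlonglongrightarrow> 0"
  by (rule LIMSEQ_offset[of _ j]) (simp add: assms)

text \<open>Along a run the error satisfies a recursion forced by the shift operator applied to the target,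
  and all error terms tend to \<open>0\<close>.\<close>

lemma target_residual_tendsto_zero:
  assumes "0 < l" "globally_convergent k \<alpha> \<beta> (iso_cost l y)"
  shows "(\<lambda>t. \<Sum>i\<le>k+1. shift_coeff k \<beta> i *\<^sub>R y (t + 1 - i)) \<longlonglongrightarrow> 0"
proof -
  obtain x where x: "is_run k \<alpha> \<beta> (iso_cost l y) x" using exists_run by blast
  define e where "e t = x t - y t" for t
  have e: "e \<longlonglongrightarrow> 0"
    using assms x by (auto simp: globally_convergent_def minimizer_iso_cost e_def[abs_def])
  have e1: "(\<lambda>t. e (t + 1 - i)) \<longlonglongrightarrow> 0" for i
    using LIMSEQ_ignore_initial_segment[OF tendsto_zero_shift_back[OF e, of i], of 1] by simp
  have "(\<lambda>t. - (\<Sum>i\<le>k+1. shift_coeff k \<beta> i *\<^sub>R e (t + 1 - i))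
      - l *\<^sub>R (\<Sum>j\<le>k. \<alpha> j *\<^sub>R e (t - j))) \<longlonglongrightarrow>
      - (\<Sum>i\<le>k+1. shift_coeff k \<beta> i *\<^sub>R 0) - l *\<^sub>R (\<Sum>j\<le>k. \<alpha> j *\<^sub>R 0)"
    by (intro tendsto_intros e1 tendsto_zero_shift_back[OF e])
  then have lim: "(\<lambda>t. - (\<Sum>i\<le>k+1. shift_coeff k \<beta> i *\<^sub>R e (t + 1 - i))
      - l *\<^sub>R (\<Sum>j\<le>k. \<alpha> j *\<^sub>R e (t - j))) \<longlonglongrightarrow> 0" by simp
  have eq: "- (\<Sum>i\<le>k+1. shift_coeff k \<beta> i *\<^sub>R e (t + 1 - i)) - l *\<^sub>R (\<Sum>j\<le>k. \<alpha> j *\<^sub>R e (t - j))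
      = (\<Sum>i\<le>k+1. shift_coeff k \<beta> i *\<^sub>R y (t + 1 - i))" if "t \<ge> k" for t
  proof -
    have "(\<Sum>i\<le>k+1. shift_coeff k \<beta> i *\<^sub>R x (t + 1 - i)) = - l *\<^sub>R (\<Sum>j\<le>k. \<alpha> j *\<^sub>R e (t - j))"
      using x that by (auto simp: is_run_iso_cost e_def eq_neg_iff_add_eq_0)
    then show ?thesis
      by (simp add: e_def scaleR_diff_right sum_subtractf del: sum.atMost_Suc)
  qed
  show ?thesis
    by (rule Lim_transform_eventually[OF lim], rule eventually_sequentiallyI[of k], rule eq)
qed

text \<open>Each monomial target \<open>t ^ l\<close> must leave a residual tending to
  \<open>0\<close>, and that residual is a combination of shifted powers.\<close>

lemma shift_coeff_moments_zero:
  fixes F :: "'p::finite cost set"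
  assumes m: "0 < m" "m \<le> L" and F: "quadratic_class n m L \<subseteq> F"
    and conv: "\<And>f. f \<in> F \<Longrightarrow> globally_convergent k \<alpha> \<beta> f" and "l < n"
  shows "(\<Sum>i\<le>k+1. shift_coeff k \<beta> i * real i ^ l) = 0"
proof (rule moments_zero_of_shifted_powers_vanish[OF _ \<open>l < n\<close>])
  fix l assume l: "l < n"
  \<comment> \<open>The coefficient \<open>1\<close> is the all-ones vector, so every coordinate
    carries the scalar monomial.\<close>
  define a :: "nat \<Rightarrow> real^'p" where "a i = (if i = l then 1 else 0)" for i
  have traj: "poly_traj n a t = (real t ^ l) *\<^sub>R 1" for t
  proof -
    have "poly_traj n a t = (\<Sum>i<n. if i = l then (real t ^ l) *\<^sub>R 1 else 0)"
      unfolding poly_traj_def a_def by (intro sum.cong) auto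
    then show ?thesis using l by simp
  qed
  obtain u :: 'p where True by blast
  have "iso_cost m (poly_traj n a) \<in> F"
    using iso_cost_in_quadratic_class[of m m L] m F by auto
  from target_residual_tendsto_zero[OF m(1) conv[OF this]]
  have "(\<lambda>t. (\<Sum>i\<le>k+1. shift_coeff k \<beta> i *\<^sub>R poly_traj n a (t + 1 - i)) $ u) \<longlonglongrightarrow> 0 $ u"
    by (rule tendsto_vec_nth)
  then have lim: "(\<lambda>t. \<Sum>i\<le>k+1. shift_coeff k \<beta> i * real (t + 1 - i) ^ l) \<longlonglongrightarrow> 0"
    by (simp add: traj del: sum.atMost_Suc)
  \<comment> \<open>For \<open>t \<ge> k\<close> the truncated subtraction is exact, since
    \<open>i \<le> k + 1 \<le> t + 1\<close>.\<close>
  have "(\<lambda>t. \<Sum>i\<le>k+1. shift_coeff k \<beta> i * (real (t + 1) - real i) ^ l) \<longlonglongrightarrow> 0"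
    by (rule Lim_transform_eventually[OF lim], rule eventually_sequentiallyI[of k], rule sum.cong)
      (auto simp: of_nat_diff)
  then have "(\<lambda>t. (\<lambda>t. \<Sum>i\<le>k+1. shift_coeff k \<beta> i * (real t - real i) ^ l) (t + 1)) \<longlonglongrightarrow> 0"
    by simp
  then show "(\<lambda>t. \<Sum>i\<le>k+1. shift_coeff k \<beta> i * (real t - real i) ^ l) \<longlonglongrightarrow> 0"
    by (rule LIMSEQ_offset)
qed

section \<open>Convergence rate and characteristic roots\<close>

lemma eventually_norm_less_power:
  fixes x :: "nat \<Rightarrow> real^'p::finite"
  assumes "convergence_rate k \<alpha> \<beta> F < ereal \<rho>" "f \<in> F" "is_run k \<alpha> \<beta> f x"
  shows "\<forall>\<^sub>F t in sequentially. norm (x t - minimizer f t) < \<rho> ^ t"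
proof -
  have "limsup (\<lambda>t. ereal (root t (norm (x t - minimizer f t)))) \<le> convergence_rate k \<alpha> \<beta> F"
    unfolding convergence_rate_def using assms(2,3) by (intro Sup_upper) blast
  then have "limsup (\<lambda>t. ereal (root t (norm (x t - minimizer f t)))) < ereal \<rho>"
    using assms(1) by (rule le_less_trans)
  then have "\<forall>\<^sub>F t in sequentially. ereal (root t (norm (x t - minimizer f t))) < ereal \<rho>"
    by (rule Limsup_lessD)
  \<comment> \<open>\<open>root 0\<close> is constantly \<open>0\<close>, so \<open>t = 0\<close> is
    discarded before taking powers.\<close>
  with eventually_gt_at_top[of "0::nat"] show ?thesis
  proof eventually_elim
    case (elim t)
    then have "root t (norm (x t - minimizer f t)) ^ t < \<rho> ^ t"
      by (intro power_strict_mono) auto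
    then show ?case using elim by simp
  qed
qed

text \<open>With \<open>z = 1 / w\<close>, the geometric sequence \<open>z ^ t\<close> solves the
  error recursion, so the rate cannot lie below \<open>norm z\<close>.\<close>

lemma characteristic_root_bound:
  fixes F :: "'p::finite cost set" and w :: complex
  assumes m: "0 < m" "m \<le> l" "l \<le> L" and F: "quadratic_class n m L \<subseteq> F"
    and rate: "convergence_rate k \<alpha> \<beta> F < ereal \<rho>" and "0 < \<rho>"
    and root: "(\<Sum>i\<le>k+1. of_real (shift_coeff k \<beta> i) * w ^ i)
      + of_real l * (\<Sum>j\<le>k. of_real (\<alpha> j) * w ^ (j + 1)) = 0"
    and "w \<noteq> 0"
  shows "1 \<le> norm w * \<rho>"
proof (rule ccontr)
  define z where "z = 1 / w"
  assume "\<not> ?thesis"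
  then have less: "\<rho> < norm z" using \<open>w \<noteq> 0\<close> by (simp add: z_def norm_divide field_simps)
  \<comment> \<open>The zero target makes each run its own error.\<close>
  define f :: "'p cost" where "f = iso_cost l (poly_traj n (\<lambda>_. 0))"
  have f: "f \<in> F" "minimizer f t = 0" for t
    using iso_cost_in_quadratic_class[of m l L n "\<lambda>_. 0"] m F
    by (auto simp: f_def minimizer_iso_cost poly_traj_def)
  obtain u :: 'p where True by blast
  have rec: "(\<Sum>i\<le>k+1. shift_coeff k \<beta> i *\<^sub>R z ^ (t + 1 - i))
      + l *\<^sub>R (\<Sum>j\<le>k. \<alpha> j *\<^sub>R z ^ (t - j)) = 0" if "k \<le> t" for t
  proof -
    have pow: "z ^ (t + 1 - i) = z ^ (t + 1) * w ^ i" if "i \<le> k + 1" for i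
      using that \<open>k \<le> t\<close> \<open>w \<noteq> 0\<close> by (simp add: z_def power_divide power_diff del: power_Suc)
    have "(\<Sum>i\<le>k+1. shift_coeff k \<beta> i *\<^sub>R z ^ (t + 1 - i))
        = (\<Sum>i\<le>k+1. z ^ (t + 1) * (of_real (shift_coeff k \<beta> i) * w ^ i))"
    proof (intro sum.cong refl)
      fix i assume "i \<in> {..k+1}"
      then show "shift_coeff k \<beta> i *\<^sub>R z ^ (t + 1 - i)
          = z ^ (t + 1) * (of_real (shift_coeff k \<beta> i) * w ^ i)"
        using pow[of i] by (simp only: scaleR_conv_of_real mult.left_commute atMost_iff)
    qed
    moreover have "(\<Sum>j\<le>k. \<alpha> j *\<^sub>R z ^ (t - j))
        = (\<Sum>j\<le>k. z ^ (t + 1) * (of_real (\<alpha> j) * w ^ (j + 1)))"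
    proof (intro sum.cong refl)
      fix j assume "j \<in> {..k}"
      then have "z ^ (t - j) = z ^ (t + 1) * w ^ (j + 1)" using pow[of "j + 1"] by simp
      then show "\<alpha> j *\<^sub>R z ^ (t - j) = z ^ (t + 1) * (of_real (\<alpha> j) * w ^ (j + 1))"
        by (simp only: scaleR_conv_of_real mult.left_commute)
    qed
    ultimately have "(\<Sum>i\<le>k+1. shift_coeff k \<beta> i *\<^sub>R z ^ (t + 1 - i))
          + l *\<^sub>R (\<Sum>j\<le>k. \<alpha> j *\<^sub>R z ^ (t - j))
        = (\<Sum>i\<le>k+1. z ^ (t + 1) * (of_real (shift_coeff k \<beta> i) * w ^ i))
          + of_real l * (\<Sum>j\<le>k. z ^ (t + 1) * (of_real (\<alpha> j) * w ^ (j + 1)))"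
      by (simp only: scaleR_conv_of_real)
    also have "\<dots> = z ^ (t + 1) * 0"
      unfolding root[symmetric] by (simp only: sum_distrib_left distrib_left mult_ac)
    finally show ?thesis by simp
  qed
  \<comment> \<open>Runs are real, so the complex solution enters through a real-linear functional,
    later \<open>Re\<close> and \<open>Im\<close>, along one coordinate axis.\<close>
  have small: "\<forall>\<^sub>F t in sequentially. \<bar>\<phi> (z ^ t)\<bar> < \<rho> ^ t"
    if "bounded_linear \<phi>" for \<phi> :: "complex \<Rightarrow> real"
  proof -
    interpret bounded_linear \<phi> by fact
    define x where "x t = (axis u (\<phi> (z ^ t)) :: real^'p)" for t
    have ax: "axis u (\<phi> c) = \<phi> c *\<^sub>R (axis u 1 :: real^'p)" for c
      by (simp add: axis_def vec_eq_iff)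
    have "is_run k \<alpha> \<beta> f x"
      unfolding f_def is_run_iso_cost
    proof (intro allI impI)
      fix t assume "k \<le> t"
      have "(\<Sum>i\<le>k+1. shift_coeff k \<beta> i *\<^sub>R x (t + 1 - i))
          + l *\<^sub>R (\<Sum>j\<le>k. \<alpha> j *\<^sub>R (x (t - j) - poly_traj n (\<lambda>_. 0) (t - j)))
        = \<phi> ((\<Sum>i\<le>k+1. shift_coeff k \<beta> i *\<^sub>R z ^ (t + 1 - i)) + l *\<^sub>R (\<Sum>j\<le>k. \<alpha> j *\<^sub>R z ^ (t - j)))
          *\<^sub>R axis u 1"
        unfolding x_def ax poly_traj_def add sum scaleR
        by (simp add: scaleR_sum_left scaleR_add_left scaleR_sum_right sum_distrib_left del: sum.atMost_Suc)
      also have "\<dots> = 0" unfolding rec[OF \<open>k \<le> t\<close>] by (simp add: zero)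
      finally show "(\<Sum>i\<le>k+1. shift_coeff k \<beta> i *\<^sub>R x (t + 1 - i))
          + l *\<^sub>R (\<Sum>j\<le>k. \<alpha> j *\<^sub>R (x (t - j) - poly_traj n (\<lambda>_. 0) (t - j))) = 0" .
    qed
    from eventually_norm_less_power[OF rate f(1) this] show ?thesis
      by (simp add: f(2) x_def ax)
  qed
  \<comment> \<open>The \<open>2\<close> absorbs the estimate of \<open>norm (z ^ t)\<close> by its
    real and imaginary parts.\<close>
  have "\<forall>\<^sub>F t in sequentially. 2 < (norm z / \<rho>) ^ t"
  proof -
    have gt: "1 < norm z / \<rho>" using less \<open>0 < \<rho>\<close> by simp
    then obtain N where N: "2 < (norm z / \<rho>) ^ N" using real_arch_pow by blast
    have "2 < (norm z / \<rho>) ^ t" if "N \<le> t" for t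
      using N power_increasing[OF that, of "norm z / \<rho>"] gt by linarith
    then show ?thesis by (rule eventually_sequentiallyI)
  qed
  with small[OF bounded_linear_Re] small[OF bounded_linear_Im]
  have "\<forall>\<^sub>F t in sequentially. False"
  proof eventually_elim
    case (elim t)
    have "norm (z ^ t) \<le> \<bar>Re (z ^ t)\<bar> + \<bar>Im (z ^ t)\<bar>" by (rule cmod_le)
    then have "norm z ^ t < 2 * \<rho> ^ t" using elim by (simp add: norm_power)
    then show False using elim \<open>0 < \<rho>\<close> by (simp add: power_divide field_simps)
  qed
  then show False by simp
qed

theorem corollary1p1:
  fixes n k :: nat
    and m L \<kappa> :: real
    and F :: "'p::finite cost set"
    and \<alpha> \<beta> :: "nat \<Rightarrow> real"
  assumes "n \<ge> 1" and "k \<ge> 1"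
    and "0 < m" and "m < L" and "\<kappa> = L / m"
    and "\<And>f. f \<in> F \<Longrightarrow> admissible_cost f"
    and "quadratic_class n m L \<subseteq> F"
    and "(\<Sum>j\<le>k. \<alpha> j) \<noteq> 0"
    and "\<And>f. f \<in> F \<Longrightarrow> globally_convergent k \<alpha> \<beta> f"
  shows "ereal (((sqrt \<kappa> - 1) / (sqrt \<kappa> + 1)) powr (1 / real n)) \<le> convergence_rate k \<alpha> \<beta> F
    \<and> ((sqrt \<kappa> - 1) / (sqrt \<kappa> + 1)) powr (1 / real n)
      = ((sqrt L - sqrt m) / (sqrt L + sqrt m)) powr (1 / real n)"
proof -
  define q where "q = (sqrt L - sqrt m) / (sqrt L + sqrt m)"
  have sq: "0 < sqrt m" "sqrt m < sqrt L" using assms(3,4) by simp_all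
  have q: "0 < q" unfolding q_def using sq by (intro divide_pos_pos) linarith+
  have eq: "(sqrt \<kappa> - 1) / (sqrt \<kappa> + 1) = q"
  proof -
    have "sqrt \<kappa> - 1 = (sqrt L - sqrt m) / sqrt m" "sqrt \<kappa> + 1 = (sqrt L + sqrt m) / sqrt m"
      unfolding assms(5) real_sqrt_divide using sq(1) by (simp_all add: diff_divide_distrib add_divide_distrib)
    then show ?thesis using sq(1) by (simp add: q_def)
  qed
  have "ereal (q powr (1 / real n)) \<le> convergence_rate k \<alpha> \<beta> F"
  proof (rule ccontr)
    assume "\<not> ?thesis"
    \<comment> \<open>\<open>max 0\<close> secures a positive \<open>\<sigma>\<close>, so that
      \<open>1 / \<sigma>\<close> is a genuine radius.\<close>
    then have lt: "max 0 (convergence_rate k \<alpha> \<beta> F) < ereal (q powr (1 / real n))"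
      using q by auto
    obtain \<sigma> where \<sigma>: "max 0 (convergence_rate k \<alpha> \<beta> F) < ereal \<sigma>" "\<sigma> < q powr (1 / real n)"
      using ereal_dense2[OF lt] by auto
    \<comment> \<open>The open disc of radius \<open>1 / \<sigma>\<close> will be free of
      characteristic roots; \<open>1 / \<rho>\<close> is a strictly smaller radius, as the maximum
      principle requires.\<close>
    obtain \<rho> where \<rho>: "\<sigma> < \<rho>" "\<rho> < q powr (1 / real n)" using dense[OF \<sigma>(2)] by blast
    have \<sigma>0: "0 < \<sigma>" "convergence_rate k \<alpha> \<beta> F < ereal \<sigma>" using \<sigma>(1) by auto
    define a where "a w = (\<Sum>i\<le>k+1. of_real (shift_coeff k \<beta> i) * w ^ i)" for w :: complex
    define p where "p w = (\<Sum>j\<le>k. of_real (\<alpha> j) * w ^ (j + 1))" for w :: complex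
    define P where "P = (\<Sum>i\<le>k+1. monom (complex_of_real (shift_coeff k \<beta> i)) i)"
    have coeff_P: "coeff P i = (if i \<le> k + 1 then of_real (shift_coeff k \<beta> i) else 0)" for i
      unfolding P_def coeff_sum by (simp del: sum.atMost_Suc)
    have "degree P \<le> k + 1" by (rule degree_le) (simp add: coeff_P)
    have "[:-1, 1:] ^ n dvd P"
    proof (rule moments_zero_imp_power_dvd)
      fix l assume "l < n"
      have "(\<Sum>i\<le>degree P. coeff P i * of_nat i ^ l) = (\<Sum>i\<le>k+1. coeff P i * of_nat i ^ l)"
        using \<open>degree P \<le> k + 1\<close> by (intro sum.mono_neutral_left) (auto simp: coeff_eq_0)
      also have "\<dots> = of_real (\<Sum>i\<le>k+1. shift_coeff k \<beta> i * real i ^ l)"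
        unfolding of_real_sum by (intro sum.cong) (auto simp: coeff_P)
      also have "\<dots> = 0"
        using shift_coeff_moments_zero[OF assms(3) less_imp_le[OF assms(4)] assms(7,9) \<open>l < n\<close>] by simp
      finally show "(\<Sum>i\<le>degree P. coeff P i * of_nat i ^ l) = 0" .
    qed
    then obtain Q where Q: "P = [:-1, 1:] ^ n * Q" by (rule dvdE)
    have "a w = poly P w" for w by (simp add: a_def P_def poly_sum poly_monom del: sum.atMost_Suc)
    \<comment> \<open>The sign \<open>(-1) ^ n\<close> turns \<open>(w - 1) ^ n\<close> into
      \<open>(1 - w) ^ n\<close>.\<close>
    then have aQ: "a w = (1 - w) ^ n * ((-1) ^ n * poly Q w)" for w
      unfolding Q by (simp add: poly_power flip: power_mult_distrib mult.assoc)
    have a0: "a 0 = 1"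
    proof -
      have "a 0 = (\<Sum>i\<le>k+1. if i = 0 then of_real (shift_coeff k \<beta> i) else 0)"
        unfolding a_def by (intro sum.cong) auto
      also have "\<dots> = 1" by (simp add: shift_coeff_def del: sum.atMost_Suc)
      finally show ?thesis .
    qed
    have p0: "p 0 = 0" by (simp add: p_def)
    have "q * (1 / \<rho>) ^ n \<le> 1"
      unfolding q_def
    proof (rule pencil_nonvanishing_radius_bound[OF assms(3,4), of a "1 / \<sigma>" "\<lambda>w. (-1) ^ n * poly Q w" p])
      show "a holomorphic_on ball 0 (1 / \<sigma>)" "p holomorphic_on ball 0 (1 / \<sigma>)"
        "(\<lambda>w. (-1) ^ n * poly Q w) holomorphic_on ball 0 (1 / \<sigma>)"
        unfolding a_def p_def by (intro holomorphic_intros)+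
      fix w :: complex and l assume w: "w \<in> ball 0 (1 / \<sigma>)" and l: "m \<le> l" "l \<le> L"
      show "a w + of_real l * p w \<noteq> 0"
      \<comment> \<open>The root bound excludes \<open>w = 0\<close>, where the pencil has the value
        \<open>a 0 = 1\<close>.\<close>
      proof (cases "w = 0")
        case False
        have "\<not> 1 \<le> norm w * \<sigma>" using w \<sigma>0(1) by (simp add: field_simps)
        then show ?thesis
          using characteristic_root_bound[OF assms(3) l assms(7) \<sigma>0(2,1) _ False]
          by (auto simp: a_def p_def simp del: sum.atMost_Suc)
      qed (simp add: a0 p0)
    qed (use aQ p0 \<sigma>0 \<rho> in \<open>auto simp: field_simps\<close>)
    then have "q \<le> \<rho> ^ n" using \<rho> \<sigma>0 by (simp add: power_divide field_simps)
    moreover have "\<rho> ^ n < (q powr (1 / real n)) ^ n"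
      using \<rho> \<sigma>0 assms(1) by (intro power_strict_mono) auto
    moreover have "(q powr (1 / real n)) ^ n = q"
      using q assms(1) by (simp add: powr_powr flip: powr_realpow)
    ultimately show False by simp
  qed
  then show ?thesis by (simp add: eq flip: q_def)
qed

end
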